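(* Let $(X_n)_{n\in\mathbb{N}}$ be a stochastic process. If $\phi$ is a modulus of finite crossings and $f$ is a modulus of uniform boundedness for $(X_n)$, then $$\psi(\lambda,\varepsilon):=l\cdot\phi\left(\frac{\lambda}{2},M,l\right)\quad\text{for } l:=\left\lceil\frac{4M}{\varepsilon}\right\rceil\ \text{ and } M:=f\left(\frac{\lambda}{2}\right)$$ is a modulus of finite fluctuations for $(X_n)$, and therefore also a learnable rate of pointwise convergence for $(X_n)$.
   Context: $\mathbb{N}=\{0,1,2,\ldots\}$, and $[m;n]:=\{m,m+1,\ldots,n\}\subset\mathbb{N}$ (empty if $n<m$). A stochastic process is a sequence $(X_n)_{n\in\mathbb{N}}$ of real-valued random variables on a probability space $(\Omega,\mathcal{F},\mathbb{P})$. For a real sequence $(x_n)$ and $\varepsilon>0$, $J_\varepsilon\{x_n\}\in\mathbb{N}\cup\{\infty\}$ is the total number of $\varepsilon$-fluctuations: the supremum of all $k$ for which there exist $i_1<j_1\leq i_2<j_2\leq\cdots\leq i_k<j_k$ with $|x_{i_l}-x_{j_l}|\geq\varepsilon$ for all $l=1,\ldots,k$. For $\alpha<\beta$, $C_{[\alpha,\beta]}\{x_n\}\in\mathbb{N}\cup\{\infty\}$ is the total number of $[\alpha,\beta]$-crossings: the supremum of all $k$ for which there exist such indices with, for each $l$, either $x_{i_l}\leq\alpha$ and $\beta\leq x_{j_l}$, or $x_{j_l}\leq\alpha$ and $\beta\leq x_{i_l}$. For processes these are defined pathwise: $J_\varepsilon\{X_n\}(\omega):=J_\varepsilon\{X_n(\omega)\}$,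 and likewise for $C$. For $M>0$ and $l\geq 1$, $\mathcal{P}(M,l):=\{[-M+\frac{2Mi}{l},-M+\frac{2M(i+1)}{l}] : i=0,\ldots,l-1\}$. Modulus of finite crossings: $\phi:(0,1)\times(0,\infty)\times\mathbb{N}\to\mathbb{R}$ with $\mathbb{P}(\exists[\alpha,\beta]\in\mathcal{P}(M,l)\ C_{[\alpha,\beta]}\{X_n\}\geq\phi(\lambda,M,l))<\lambda$ for all $\lambda\in(0,1)$, $M\in(0,\infty)$, $l\in\mathbb{N}$. Modulus of uniform boundedness: $f:(0,1)\to\mathbb{R}$ with $\mathbb{P}(\sup_{n\in\mathbb{N}}|X_n|\geq f(\lambda))<\lambda$ for all $\lambda\in(0,1)$ (in particular $f(\lambda)>0$). Modulus of finite fluctuations: $\psi:(0,1)\times(0,1)\to\mathbb{R}$ with $\mathbb{P}(J_\varepsilon\{X_n\}\geq\psi(\lambda,\varepsilon))<\lambda$ for all $\lambda,\varepsilon\in(0,1)$. Learnable rate of pointwise convergence: $\psi:(0,1)\times(0,1)\to\mathbb{R}$ such that for all $\lambda,\varepsilon\in(0,1)$ and all natural numbers $a_0<b_0\leq a_1<b_1\leq\cdots$, $\mathbb{P}(\forall n\leq\psi(\lambda,\varepsilon)\ \exists i,j\in[a_n;b_n]\ (|X_i-X_j|\geq\varepsilon))<\lambda$, where $n$ ranges over $\mathbb{N}$. *)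

theory Defs
  imports "HOL-Probability.Probability"
begin

text \<open>
  The index pairs \<open>i\<^sub>1 < j\<^sub>1 \<le> i\<^sub>2 < j\<^sub>2 \<le> \<dots> \<le> i\<^sub>k < j\<^sub>k\<close> are numbered from \<open>0\<close>; only the first
  \<open>k\<close> entries of \<open>i\<close> and \<open>j\<close> matter.
\<close>

definition chained_pairs :: "nat \<Rightarrow> (nat \<Rightarrow> nat) \<Rightarrow> (nat \<Rightarrow> nat) \<Rightarrow> bool" where
  "chained_pairs k i j \<longleftrightarrow>
     (\<forall>l<k. i l < j l) \<and> (\<forall>l. Suc l < k \<longrightarrow> j l \<le> i (Suc l))"

definition fluctuations :: "real \<Rightarrow> (nat \<Rightarrow> real) \<Rightarrow> enat" where
  "fluctuations \<epsilon> x =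
     Sup {enat k | k. \<exists>i j. chained_pairs k i j \<and> (\<forall>l<k. \<bar>x (i l) - x (j l)\<bar> \<ge> \<epsilon>)}"

definition crossings :: "real \<Rightarrow> real \<Rightarrow> (nat \<Rightarrow> real) \<Rightarrow> enat" where
  "crossings \<alpha> \<beta> x =
     Sup {enat k | k. \<exists>i j. chained_pairs k i j \<and>
       (\<forall>l<k. (x (i l) \<le> \<alpha> \<and> \<beta> \<le> x (j l)) \<or> (x (j l) \<le> \<alpha> \<and> \<beta> \<le> x (i l)))}"

text \<open>
  An interval \<open>[\<alpha>,\<beta>]\<close> is represented by the pair of its endpoints. For \<open>l = 0\<close> the partition is
  empty, so that the value at \<open>l = 0\<close> of a modulus of finite crossings is unconstrained.
\<close>

definition partition_intervals :: "real \<Rightarrow> nat \<Rightarrow> (real \<times> real) set" where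
  "partition_intervals M l =
     {(- M + 2 * M * real i / real l, - M + 2 * M * (real i + 1) / real l) | i. i < l}"

text \<open>
  The moduli are total functions constrained only on the domains given by their quantifiers.
  For a probability space \<open>P\<close> and random variables \<open>X n\<close>, all events below are measurable,
  being obtained from countably many conditions on the \<open>X n\<close>.
\<close>

definition modulus_of_finite_crossings ::
    "'a measure \<Rightarrow> (nat \<Rightarrow> 'a \<Rightarrow> real) \<Rightarrow> (real \<Rightarrow> real \<Rightarrow> nat \<Rightarrow> real) \<Rightarrow> bool" where
  "modulus_of_finite_crossings P X \<phi> \<longleftrightarrow>
     (\<forall>lam\<in>{0<..<1}. \<forall>M>0. \<forall>l.
        measure P {\<omega> \<in> space P. \<exists>(\<alpha>, \<beta>) \<in> partition_intervals M l.
          ereal_of_enat (crossings \<alpha> \<beta> (\<lambda>n. X n \<omega>)) \<ge> ereal (\<phi> lam M l)} < lam)"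

definition modulus_of_uniform_boundedness ::
    "'a measure \<Rightarrow> (nat \<Rightarrow> 'a \<Rightarrow> real) \<Rightarrow> (real \<Rightarrow> real) \<Rightarrow> bool" where
  "modulus_of_uniform_boundedness P X f \<longleftrightarrow>
     (\<forall>lam\<in>{0<..<1}.
        measure P {\<omega> \<in> space P. (SUP n. ereal \<bar>X n \<omega>\<bar>) \<ge> ereal (f lam)} < lam)"

definition modulus_of_finite_fluctuations ::
    "'a measure \<Rightarrow> (nat \<Rightarrow> 'a \<Rightarrow> real) \<Rightarrow> (real \<Rightarrow> real \<Rightarrow> real) \<Rightarrow> bool" where
  "modulus_of_finite_fluctuations P X \<psi> \<longleftrightarrow>
     (\<forall>lam\<in>{0<..<1}. \<forall>\<epsilon>\<in>{0<..<1}.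
        measure P {\<omega> \<in> space P.
          ereal_of_enat (fluctuations \<epsilon> (\<lambda>n. X n \<omega>)) \<ge> ereal (\<psi> lam \<epsilon>)} < lam)"

definition learnable_rate_of_pointwise_convergence ::
    "'a measure \<Rightarrow> (nat \<Rightarrow> 'a \<Rightarrow> real) \<Rightarrow> (real \<Rightarrow> real \<Rightarrow> real) \<Rightarrow> bool" where
  "learnable_rate_of_pointwise_convergence P X \<psi> \<longleftrightarrow>
     (\<forall>lam\<in>{0<..<1}. \<forall>\<epsilon>\<in>{0<..<1}. \<forall>a b :: nat \<Rightarrow> nat.
        (\<forall>n. a n < b n \<and> b n \<le> a (Suc n)) \<longrightarrow>
        measure P {\<omega> \<in> space P. \<forall>n::nat. real n \<le> \<psi> lam \<epsilon> \<longrightarrow>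
          (\<exists>i\<in>{a n..b n}. \<exists>j\<in>{a n..b n}. \<bar>X i \<omega> - X j \<omega>\<bar> \<ge> \<epsilon>)} < lam)"

end

theory Submission
  imports Defs
begin

text \<open>
  Fix \<open>\<lambda>\<close> and \<open>\<epsilon>\<close>, and take \<open>M\<close> and \<open>l\<close> as in the theorem. The choice of \<open>l\<close> makes the \<open>l\<close>
  intervals that partition \<open>[-M, M]\<close> at most \<open>\<epsilon> / 2\<close> wide. Two points of \<open>(-M, M)\<close> at distance at
  least \<open>\<epsilon>\<close> therefore have an entire partition interval between them
  (\<open>partition_interval_between\<close>), so that for a path bounded by \<open>M\<close> each \<open>\<epsilon>\<close>-fluctuation crosses
  one of the intervals. Sorting the fluctuations by the interval that they cross, and noting that
  any selection from a chain of index pairs is again such a chain, the number of fluctuations is at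
  most the sum of the \<open>l\<close> numbers of crossings (\<open>card_le_sum_max_chain\<close>). If every one of these
  is below \<open>\<phi> (\<lambda>/2) M l\<close>, the sum is below \<open>l\<close> times this value. Hence the event that there are
  too many fluctuations lies in the union of two events, that \<open>\<bar>X n\<bar>\<close> has supremum at least \<open>M\<close>
  and that some interval is crossed too often, each of probability less than \<open>\<lambda>/2\<close>.

  A modulus of finite fluctuations is a learnable rate because fluctuations found in each of the
  intervals \<open>[a\<^sub>n; b\<^sub>n]\<close> with \<open>n \<le> \<psi>\<close> form one chain. Its length is
  \<open>\<lfloor>\<psi>\<rfloor> + 1\<close>, or \<open>0\<close> for negative \<open>\<psi>\<close>, so in either case at least \<open>\<psi>\<close>
  (\<open>fluctuations_ge_of_each_block\<close>).

  Both steps compare probabilities by inclusion of events, which needs the larger event to be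
  measurable. Fluctuations and crossings are treated together, as the supremum of the lengths of the chains of
  index pairs that satisfy a given relation; only finite initial segments of the index functions
  matter, so that countably many conditions describe it (\<open>measurable_max_chain\<close>).
\<close>

section \<open>Chains of index pairs\<close>

definition max_chain :: "(nat \<Rightarrow> nat \<Rightarrow> bool) \<Rightarrow> enat" where
  "max_chain R = Sup {enat k | k. \<exists>i j. chained_pairs k i j \<and> (\<forall>l<k. R (i l) (j l))}"

definition crosses :: "real \<Rightarrow> real \<Rightarrow> (nat \<Rightarrow> real) \<Rightarrow> nat \<Rightarrow> nat \<Rightarrow> bool" where
  "crosses \<alpha> \<beta> x i j \<longleftrightarrow> x i \<le> \<alpha> \<and> \<beta> \<le> x j \<or> x j \<le> \<alpha> \<and> \<beta> \<le> x i"

lemma fluctuations_eq_max_chain: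
  "fluctuations \<epsilon> x = max_chain (\<lambda>i j. \<epsilon> \<le> \<bar>x i - x j\<bar>)"
  by (simp add: fluctuations_def max_chain_def)

lemma crossings_eq_max_chain: "crossings \<alpha> \<beta> x = max_chain (crosses \<alpha> \<beta> x)"
  by (simp add: crossings_def max_chain_def crosses_def)

lemma max_chain_ge:
  assumes "chained_pairs k i j" "\<And>l. l < k \<Longrightarrow> R (i l) (j l)"
  shows "enat k \<le> max_chain R"
  unfolding max_chain_def using assms by (intro Sup_upper) blast

lemma max_chain_le:
  assumes "\<And>k i j. chained_pairs k i j \<Longrightarrow> (\<And>l. l < k \<Longrightarrow> R (i l) (j l)) \<Longrightarrow> enat k \<le> c"
  shows "max_chain R \<le> c"
  unfolding max_chain_def using assms by (intro Sup_least) blast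

lemma chained_pairs_le:
  assumes "chained_pairs k i j" "p < q" "q < k"
  shows "j p \<le> i q"
  using assms(2,3)
proof (induction q)
  case (Suc q)
  have step: "j q \<le> i (Suc q)" "i q < j q"
    using assms(1) Suc.prems by (auto simp: chained_pairs_def)
  show ?case
  proof (cases "p = q")
    case False
    then have "j p \<le> i q" using Suc by simp
    then show ?thesis using step by simp
  qed (use step in simp)
qed simp

text \<open>
  The pairs selected by \<open>A\<close>, listed in increasing order, still form a chain, as the gaps left by
  the discarded pairs only push consecutive ones further apart.
\<close>

lemma card_le_max_chain:
  assumes "chained_pairs k i j" "A \<subseteq> {..<k}" "\<And>p. p \<in> A \<Longrightarrow> R (i p) (j p)"
  shows "enat (card A) \<le> max_chain R"
proof -
  define e where "e l = sorted_list_of_set A ! l" for l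
  have fin: "finite A" using assms(2) finite_subset by blast
  have e_in: "e l \<in> A" if "l < card A" for l
    using that fin by (metis e_def length_sorted_list_of_set nth_mem set_sorted_list_of_set)
  have e_less: "e l < e (Suc l)" if "Suc l < card A" for l
    using that strict_sorted_list_of_set[of A] fin
    by (simp add: e_def sorted_wrt_iff_nth_less)
  have "chained_pairs (card A) (i \<circ> e) (j \<circ> e)"
    unfolding chained_pairs_def
  proof (intro conjI allI impI)
    fix l assume "l < card A"
    then show "(i \<circ> e) l < (j \<circ> e) l"
      using e_in assms(1,2) by (auto simp: chained_pairs_def)
  next
    fix l assume l: "Suc l < card A"
    then have "e (Suc l) < k" using e_in assms(2) by blast
    then show "(j \<circ> e) l \<le> (i \<circ> e) (Suc l)"
      using chained_pairs_le[OF assms(1) e_less[OF l]] by simp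
  qed
  then show ?thesis
    using e_in assms(3) by (intro max_chain_ge) auto
qed

lemma card_le_sum_max_chain:
  fixes n :: nat
  assumes "chained_pairs k i j" "\<And>p. p < k \<Longrightarrow> \<exists>m<n. R m (i p) (j p)"
  shows "enat k \<le> (\<Sum>m<n. max_chain (R m))"
proof -
  define A where "A m = {p. p < k \<and> R m (i p) (j p)}" for m
  have "{..<k} \<subseteq> (\<Union>m<n. A m)"
    using assms(2) by (force simp: A_def)
  moreover have "finite (\<Union>m<n. A m)" by (simp add: A_def)
  ultimately have "k \<le> card (\<Union>m<n. A m)"
    using card_mono[of "\<Union>m<n. A m" "{..<k}"] by simp
  also have "\<dots> \<le> (\<Sum>m<n. card (A m))"
    by (rule card_UN_le) simp
  finally have "enat k \<le> enat (\<Sum>m<n. card (A m))" by simp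
  also have "\<dots> = (\<Sum>m<n. enat (card (A m)))"
    by (induction n) (simp_all flip: plus_enat_simps(1) add: zero_enat_def)
  also have "\<dots> \<le> (\<Sum>m<n. max_chain (R m))"
    by (intro sum_mono card_le_max_chain[OF assms(1)]) (auto simp: A_def)
  finally show ?thesis .
qed

section \<open>Fluctuations of a bounded path cross partition intervals\<close>

text \<open>
  The interval is the first one whose left endpoint is at or above \<open>u\<close>. It ends less than two
  widths above \<open>u\<close>, hence below \<open>v\<close>, and so before the right end \<open>M\<close> of the partition.
\<close>

lemma partition_interval_between:
  fixes u v M :: real
  assumes "- M < u" "v < M" "u + \<epsilon> \<le> v" "0 < M" "4 * M / \<epsilon> \<le> real l" "0 < \<epsilon>"
  shows "\<exists>m<l. u \<le> - M + 2 * M * real m / real l \<and> - M + 2 * M * (real m + 1) / real l \<le> v"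
proof -
  have "0 < 4 * M / \<epsilon>" using assms by simp
  then have l: "0 < real l" using assms by linarith
  define w where "w = 2 * M / real l"
  have w: "0 < w" using l assms by (simp add: w_def)
  have lw: "real l * w = 2 * M" using l by (simp add: w_def)
  have w2: "2 * w \<le> \<epsilon>"
    using assms l by (simp add: w_def field_simps)
  define m where "m = nat \<lceil>(u + M) / w\<rceil>"
  have "0 < (u + M) / w" using assms w by simp
  then have m: "(u + M) / w \<le> real m" "real m < (u + M) / w + 1"
    unfolding m_def by linarith+
  have lower: "u + M \<le> real m * w" using m(1) w by (simp add: field_simps)
  have upper: "real m * w < u + M + w" using m(2) w by (simp add: field_simps)
  have below: "(real m + 1) * w \<le> v + M"
    using upper w2 assms by (simp add: algebra_simps)
  then have "real m * w < real l * w"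
    using w lw assms by (simp add: algebra_simps)
  then have "m < l" using w by simp
  moreover have "2 * M * real m / real l = real m * w"
    "2 * M * (real m + 1) / real l = (real m + 1) * w"
    by (simp_all add: w_def)
  ultimately show ?thesis using lower below by (intro exI[of _ m]) auto
qed

lemma fluctuations_less_of_crossings_less:
  fixes x :: "nat \<Rightarrow> real"
  assumes "0 < \<epsilon>" "0 < M" "4 * M / \<epsilon> \<le> real l" "\<And>n. \<bar>x n\<bar> < M"
    and cross: "\<And>\<alpha> \<beta>. (\<alpha>, \<beta>) \<in> partition_intervals M l \<Longrightarrow>
      ereal_of_enat (crossings \<alpha> \<beta> x) < ereal c"
  shows "ereal_of_enat (fluctuations \<epsilon> x) < ereal (real l * c)"
proof -
  define lo where "lo m = - M + 2 * M * real m / real l" for m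
  define hi where "hi m = - M + 2 * M * (real m + 1) / real l" for m
  have "\<exists>d. crossings (lo m) (hi m) x = enat d \<and> real d < c" if "m < l" for m
  proof -
    have "(lo m, hi m) \<in> partition_intervals M l"
      using that by (auto simp: partition_intervals_def lo_def hi_def)
    from cross[OF this] show ?thesis
      by (cases "crossings (lo m) (hi m) x") auto
  qed
  then obtain d where d: "\<And>m. m < l \<Longrightarrow> crossings (lo m) (hi m) x = enat (d m)"
    "\<And>m. m < l \<Longrightarrow> real (d m) < c"
    by metis
  have between: "\<exists>m<l. crosses (lo m) (hi m) x p q" if "\<epsilon> \<le> \<bar>x p - x q\<bar>" for p q
  proof (cases "x p \<le> x q")
    case True
    then have "x p + \<epsilon> \<le> x q" using that by simp
    then show ?thesis
      using partition_interval_between[of M "x p" "x q" \<epsilon> l] assms(1-3)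
        assms(4)[of p] assms(4)[of q]
      by (auto simp: crosses_def lo_def hi_def abs_less_iff)
  next
    case False
    then have "x q + \<epsilon> \<le> x p" using that by simp
    then show ?thesis
      using partition_interval_between[of M "x q" "x p" \<epsilon> l] assms(1-3)
        assms(4)[of p] assms(4)[of q]
      by (auto simp: crosses_def lo_def hi_def abs_less_iff)
  qed
  have "fluctuations \<epsilon> x \<le> (\<Sum>m<l. max_chain (crosses (lo m) (hi m) x))"
    unfolding fluctuations_eq_max_chain
    by (intro max_chain_le card_le_sum_max_chain between) auto
  also have "\<dots> = (\<Sum>m<l. enat (d m))"
    using d(1) by (simp add: crossings_eq_max_chain)
  also have "\<dots> = enat (\<Sum>m<l. d m)"
    by (induction l) (simp_all add: zero_enat_def)
  finally have "ereal_of_enat (fluctuations \<epsilon> x) \<le> ereal (\<Sum>m<l. real (d m))"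
    by (cases "fluctuations \<epsilon> x") (simp_all flip: of_nat_sum)
  moreover have "0 < 4 * M / \<epsilon>" using assms(1,2) by simp
  then have "0 < real l" using assms(3) by linarith
  then have "(\<Sum>m<l. real (d m)) < (\<Sum>m<l. c)"
    using d(2) by (intro sum_strict_mono) auto
  ultimately show ?thesis
    by (simp add: order_le_less_trans)
qed

section \<open>Fluctuations in consecutive blocks\<close>

lemma fluctuations_ge_of_each_block:
  fixes x :: "nat \<Rightarrow> real"
  assumes "0 < \<epsilon>" "\<And>n. b n \<le> a (Suc n)"
    and block: "\<And>n. real n \<le> c \<Longrightarrow> \<exists>i\<in>{a n..b n}. \<exists>j\<in>{a n..b n}. \<epsilon> \<le> \<bar>x i - x j\<bar>"
  shows "ereal c \<le> ereal_of_enat (fluctuations \<epsilon> x)"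
proof -
  \<comment> \<open>The number of \<open>n\<close> with \<open>real n \<le> c\<close>; it is \<open>0\<close> exactly for negative \<open>c\<close>.\<close>
  define k where "k = nat (\<lfloor>c\<rfloor> + 1)"
  have less_k: "real n \<le> c" if "n < k" for n
    using that unfolding k_def by linarith
  have "\<exists>i j. a n \<le> i \<and> i < j \<and> j \<le> b n \<and> \<epsilon> \<le> \<bar>x i - x j\<bar>"
    if n: "n < k" for n
  proof -
    obtain i j where ij: "i \<in> {a n..b n}" "j \<in> {a n..b n}" "\<epsilon> \<le> \<bar>x i - x j\<bar>"
      using block[OF less_k[OF n]] by blast
    then have "i \<noteq> j" using assms(1) by auto
    then show ?thesis
      using ij by (intro exI[of _ "min i j"] exI[of _ "max i j"])
        (auto simp: min_def max_def abs_minus_commute)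
  qed
  then obtain i j where ij: "\<And>n. n < k \<Longrightarrow> a n \<le> i n \<and> i n < j n \<and> j n \<le> b n \<and>
      \<epsilon> \<le> \<bar>x (i n) - x (j n)\<bar>"
    by metis
  have "chained_pairs k i j"
    unfolding chained_pairs_def
    using ij assms(2) by (meson Suc_lessD le_trans)
  then have "enat k \<le> fluctuations \<epsilon> x"
    unfolding fluctuations_eq_max_chain by (rule max_chain_ge) (use ij in blast)
  then have "ereal_of_enat (enat k) \<le> ereal_of_enat (fluctuations \<epsilon> x)"
    by (simp only: ereal_of_enat_le_iff)
  moreover have "c \<le> real k" unfolding k_def by linarith
  then have "ereal c \<le> ereal_of_enat (enat k)" by simp
  ultimately show ?thesis by (rule order_trans[rotated])
qed

section \<open>Measurability of the numbers of fluctuations and crossings\<close>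

text \<open>Lists of indices replace the index functions, since there are only countably many lists.\<close>

lemma ex_chain_iff_ex_lists:
  "(\<exists>i j. chained_pairs k i j \<and> (\<forall>l<k. R (i l) (j l))) \<longleftrightarrow>
   (\<exists>is js. chained_pairs k ((!) is) ((!) js) \<and> (\<forall>l<k. R (is ! l) (js ! l)))"
proof
  assume "\<exists>i j. chained_pairs k i j \<and> (\<forall>l<k. R (i l) (j l))"
  then obtain i j where "chained_pairs k i j" "\<forall>l<k. R (i l) (j l)" by blast
  then show "\<exists>is js. chained_pairs k ((!) is) ((!) js) \<and> (\<forall>l<k. R (is ! l) (js ! l))"
    by (intro exI[of _ "map i [0..<k]"] exI[of _ "map j [0..<k]"])
      (auto simp: chained_pairs_def)
qed blast

lemma ereal_max_chain_eq_SUP: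
  "ereal_of_enat (max_chain R) =
   (SUP k. ereal (if \<exists>i j. chained_pairs k i j \<and> (\<forall>l<k. R (i l) (j l)) then real k else 0))"
  (is "_ = (SUP k. ereal (if ?Q k then _ else _))")
proof -
  \<comment> \<open>The value \<open>0\<close> for unattained lengths is harmless, as the empty chain always exists.\<close>
  have "max_chain R = (SUP k. enat (if ?Q k then k else 0))"
    unfolding max_chain_def
  proof (intro antisym SUP_least, rule Sup_least)
    fix y assume "y \<in> {enat k | k. ?Q k}"
    then obtain k where "y = enat k" "?Q k" by blast
    then show "y \<le> (SUP k. enat (if ?Q k then k else 0))"
      by (intro SUP_upper2[of k]) auto
  next
    fix k
    show "enat (if ?Q k then k else 0) \<le> Sup {enat k | k. ?Q k}"
    proof (cases "?Q k")
      case True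
      then have "enat k \<le> Sup {enat k | k. ?Q k}" by (intro Sup_upper) blast
      then show ?thesis by (simp only: if_P[OF True])
    next
      case False
      then show ?thesis by (simp only: if_False zero_enat_def[symmetric] zero_le)
    qed
  qed
  then have "ereal_of_enat (max_chain R) = (SUP k. ereal_of_enat (enat (if ?Q k then k else 0)))"
    by (simp only: ereal_of_enat_SUP[OF UNIV_not_empty])
  also have "\<dots> = (SUP k. ereal (if ?Q k then real k else 0))"
    by (intro SUP_cong) auto
  finally show ?thesis .
qed

lemma measurable_max_chain:
  assumes R: "\<And>i j. Measurable.pred P (\<lambda>\<omega>. R \<omega> i j)"
  shows "(\<lambda>\<omega>. ereal_of_enat (max_chain (R \<omega>))) \<in> borel_measurable P"
proof -
  note [measurable] = R
  show ?thesis
    unfolding ereal_max_chain_eq_SUP ex_chain_iff_ex_lists by measurable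
qed

lemma measurable_fluctuations:
  assumes "\<And>n. X n \<in> borel_measurable P"
  shows "(\<lambda>\<omega>. ereal_of_enat (fluctuations \<epsilon> (\<lambda>n. X n \<omega>))) \<in> borel_measurable P"
proof -
  note [measurable] = assms
  show ?thesis
    unfolding fluctuations_eq_max_chain by (rule measurable_max_chain) measurable
qed

lemma measurable_crossings:
  assumes "\<And>n. X n \<in> borel_measurable P"
  shows "(\<lambda>\<omega>. ereal_of_enat (crossings \<alpha> \<beta> (\<lambda>n. X n \<omega>))) \<in> borel_measurable P"
proof -
  note [measurable] = assms
  show ?thesis
    unfolding crossings_eq_max_chain crosses_def by (rule measurable_max_chain) measurable
qed

lemma finite_partition_intervals: "finite (partition_intervals M l)"
proof -
  have "partition_intervals M l =
      (\<lambda>i. (- M + 2 * M * real i / real l, - M + 2 * M * (real i + 1) / real l)) ` {..<l}"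
    by (auto simp: partition_intervals_def)
  then show ?thesis by simp
qed

lemma sets_many_crossings:
  assumes "\<And>n. X n \<in> borel_measurable P"
  shows "{\<omega> \<in> space P. \<exists>(\<alpha>, \<beta>) \<in> partition_intervals M l.
    ereal c \<le> ereal_of_enat (crossings \<alpha> \<beta> (\<lambda>n. X n \<omega>))} \<in> sets P"
proof -
  note [measurable] = measurable_crossings[of X P, OF assms]
  have "{\<omega> \<in> space P. ereal c \<le> ereal_of_enat (crossings \<alpha> \<beta> (\<lambda>n. X n \<omega>))} \<in> sets P" for \<alpha> \<beta>
    by measurable
  then show ?thesis
    unfolding case_prod_unfold using finite_partition_intervals
    by (intro sets.sets_Collect_finite_Ex) auto
qed

section \<open>The moduli\<close>

context prob_space
begin

text \<open>A nonpositive bound would be reached by every path, an event of probability \<open>1\<close>.\<close>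

lemma modulus_of_uniform_boundedness_pos:
  assumes "modulus_of_uniform_boundedness M X f" "lam \<in> {0<..<1}"
  shows "0 < f lam"
proof (rule ccontr)
  assume "\<not> 0 < f lam"
  then have "ereal (f lam) \<le> (SUP n. ereal \<bar>X n \<omega>\<bar>)" for \<omega>
    by (intro SUP_upper2[of 0]) auto
  then have "{\<omega> \<in> space M. ereal (f lam) \<le> (SUP n. ereal \<bar>X n \<omega>\<bar>)} = space M" by blast
  moreover have "prob {\<omega> \<in> space M. ereal (f lam) \<le> (SUP n. ereal \<bar>X n \<omega>\<bar>)} < lam"
    using assms unfolding modulus_of_uniform_boundedness_def by blast
  ultimately have "prob (space M) < lam" by (simp only:)
  then show False using assms(2) by (simp add: prob_space)
qed

lemma modulus_of_finite_fluctuations_from_crossings: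
  assumes X: "\<And>n. X n \<in> borel_measurable M"
    and \<phi>: "modulus_of_finite_crossings M X \<phi>"
    and f: "modulus_of_uniform_boundedness M X f"
  shows "modulus_of_finite_fluctuations M X
    (\<lambda>lam \<epsilon>. let B = f (lam / 2); l = nat \<lceil>4 * B / \<epsilon>\<rceil> in real l * \<phi> (lam / 2) B l)"
  unfolding modulus_of_finite_fluctuations_def Let_def
proof (intro ballI)
  fix lam \<epsilon> :: real
  assume lam: "lam \<in> {0<..<1}" and \<epsilon>: "\<epsilon> \<in> {0<..<1}"
  define B where "B = f (lam / 2)"
  define l where "l = nat \<lceil>4 * B / \<epsilon>\<rceil>"
  define c where "c = \<phi> (lam / 2) B l"
  have lam2: "lam / 2 \<in> {0<..<1}" using lam by auto
  have B: "0 < B"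
    unfolding B_def using modulus_of_uniform_boundedness_pos[OF f lam2] .
  have l: "4 * B / \<epsilon> \<le> real l" unfolding l_def by linarith
  define U where "U = {\<omega> \<in> space M. (SUP n. ereal \<bar>X n \<omega>\<bar>) \<ge> ereal B}"
  define C where "C = {\<omega> \<in> space M. \<exists>(\<alpha>, \<beta>) \<in> partition_intervals B l.
    ereal_of_enat (crossings \<alpha> \<beta> (\<lambda>n. X n \<omega>)) \<ge> ereal c}"
  define J where "J = {\<omega> \<in> space M.
    ereal_of_enat (fluctuations \<epsilon> (\<lambda>n. X n \<omega>)) \<ge> ereal (real l * c)}"
  note [measurable] = X
  have U: "U \<in> sets M" unfolding U_def by measurable
  have C: "C \<in> sets M" unfolding C_def by (rule sets_many_crossings[OF X])
  have "\<omega> \<in> U \<union> C" if "\<omega> \<in> J" for \<omega>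
  proof (rule ccontr)
    assume "\<omega> \<notin> U \<union> C"
    then have nU: "(SUP n. ereal \<bar>X n \<omega>\<bar>) < ereal B"
      and nC: "\<And>\<alpha> \<beta>. (\<alpha>, \<beta>) \<in> partition_intervals B l \<Longrightarrow>
        ereal_of_enat (crossings \<alpha> \<beta> (\<lambda>n. X n \<omega>)) < ereal c"
      using that by (auto simp: U_def C_def J_def not_le)
    have "ereal \<bar>X n \<omega>\<bar> < ereal B" for n
      by (rule le_less_trans[OF SUP_upper nU]) simp
    then have "\<bar>X n \<omega>\<bar> < B" for n by simp
    then have "ereal_of_enat (fluctuations \<epsilon> (\<lambda>n. X n \<omega>)) < ereal (real l * c)"
      using \<epsilon> B l nC by (intro fluctuations_less_of_crossings_less) auto
    then show False using that by (auto simp: J_def dest: leD)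
  qed
  then have "prob J \<le> prob (U \<union> C)"
    using U C by (intro finite_measure_mono) auto
  also have "\<dots> \<le> prob U + prob C"
    using U C by (rule measure_Un_le)
  also have "\<dots> < lam / 2 + lam / 2"
  proof (rule add_strict_mono)
    show "prob U < lam / 2"
      using f lam2 unfolding modulus_of_uniform_boundedness_def U_def B_def by blast
    show "prob C < lam / 2"
      using \<phi> lam2 B unfolding modulus_of_finite_crossings_def C_def c_def by blast
  qed
  finally show "prob {\<omega> \<in> space M. ereal_of_enat (fluctuations \<epsilon> (\<lambda>n. X n \<omega>)) \<ge>
      ereal (real (nat \<lceil>4 * f (lam / 2) / \<epsilon>\<rceil>) *
        \<phi> (lam / 2) (f (lam / 2)) (nat \<lceil>4 * f (lam / 2) / \<epsilon>\<rceil>))} < lam"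
    unfolding J_def c_def l_def B_def by simp
qed

lemma learnable_rate_from_modulus_of_finite_fluctuations:
  assumes X: "\<And>n. X n \<in> borel_measurable M"
    and \<psi>: "modulus_of_finite_fluctuations M X \<psi>"
  shows "learnable_rate_of_pointwise_convergence M X \<psi>"
  unfolding learnable_rate_of_pointwise_convergence_def
proof (intro ballI allI impI)
  fix lam \<epsilon> :: real and a b :: "nat \<Rightarrow> nat"
  assume lam: "lam \<in> {0<..<1}" and \<epsilon>: "\<epsilon> \<in> {0<..<1}"
    and ab: "\<forall>n. a n < b n \<and> b n \<le> a (Suc n)"
  let ?J = "{\<omega> \<in> space M.
    ereal_of_enat (fluctuations \<epsilon> (\<lambda>n. X n \<omega>)) \<ge> ereal (\<psi> lam \<epsilon>)}"
  let ?L = "{\<omega> \<in> space M. \<forall>n::nat. real n \<le> \<psi> lam \<epsilon> \<longrightarrow>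
    (\<exists>i\<in>{a n..b n}. \<exists>j\<in>{a n..b n}. \<bar>X i \<omega> - X j \<omega>\<bar> \<ge> \<epsilon>)}"
  note [measurable] = measurable_fluctuations[of X M, OF X]
  have "?J \<in> sets M" by measurable
  moreover have "?L \<subseteq> ?J"
  proof safe
    fix \<omega>
    assume "\<forall>n::nat. real n \<le> \<psi> lam \<epsilon> \<longrightarrow>
      (\<exists>i\<in>{a n..b n}. \<exists>j\<in>{a n..b n}. \<bar>X i \<omega> - X j \<omega>\<bar> \<ge> \<epsilon>)"
    then show "ereal (\<psi> lam \<epsilon>) \<le> ereal_of_enat (fluctuations \<epsilon> (\<lambda>n. X n \<omega>))"
      using \<epsilon> ab by (intro fluctuations_ge_of_each_block[of \<epsilon> b a]) auto
  qed
  ultimately have "prob ?L \<le> prob ?J" by (intro finite_measure_mono)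
  also have "\<dots> < lam"
    using \<psi> lam \<epsilon> unfolding modulus_of_finite_fluctuations_def by blast
  finally show "prob ?L < lam" .
qed

end

theorem theorem5p1:
  fixes P :: "'a measure"
    and X :: "nat \<Rightarrow> 'a \<Rightarrow> real"
    and \<phi> :: "real \<Rightarrow> real \<Rightarrow> nat \<Rightarrow> real"
    and f :: "real \<Rightarrow> real"
  assumes "prob_space P"
    and "\<And>n. X n \<in> borel_measurable P"
    and "modulus_of_finite_crossings P X \<phi>"
    and "modulus_of_uniform_boundedness P X f"
  shows "let \<psi> = (\<lambda>lam \<epsilon>. let M = f (lam / 2); l = nat \<lceil>4 * M / \<epsilon>\<rceil> in real l * \<phi> (lam / 2) M l)
         in modulus_of_finite_fluctuations P X \<psi> \<and>
            learnable_rate_of_pointwise_convergence P X \<psi>"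
proof -
  interpret prob_space P by fact
  have "modulus_of_finite_fluctuations P X
    (\<lambda>lam \<epsilon>. let M = f (lam / 2); l = nat \<lceil>4 * M / \<epsilon>\<rceil> in real l * \<phi> (lam / 2) M l)"
    by (rule modulus_of_finite_fluctuations_from_crossings[OF assms(2-4)])
  from this learnable_rate_from_modulus_of_finite_fluctuations[OF assms(2) this]
  show ?thesis
    unfolding Let_def by blast
qed

end
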